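(* Consider the Diophantine equation $A^2+B^2+C^2=3D^2$ in integers. For integers $x,y,z,t$ put $$\begin{aligned} \mathcal A(x,y,z,t)&=x^2+y^2-z^2-t^2+2(yz+yt+xz-xt),\\ \mathcal B(x,y,z,t)&=x^2-y^2+z^2-t^2+2(yz+zt+xt-xy),\\ \mathcal C(x,y,z,t)&=x^2-y^2-z^2+t^2+2(yt+zt+xy-xz),\\ \mathcal D(x,y,z,t)&=x^2+y^2+z^2+t^2. \end{aligned}$$ (1) Every primitive integer solution is, up to a change of signs, of this form: if $(A,B,C,D)$ is a primitive solution of $A^2+B^2+C^2=3D^2$, then there exist $x,y,z,t\in\mathbb Z$ and signs $\varepsilon_1,\varepsilon_2,\varepsilon_3,\varepsilon_4\in\{1,-1\}$ such that $\varepsilon_1A=\mathcal A(x,y,z,t)$, $\varepsilon_2B=\mathcal B(x,y,z,t)$, $\varepsilon_3C=\mathcal C(x,y,z,t)$ and $\varepsilon_4D=\mathcal D(x,y,z,t)$. (2) For all integers $x,y,z,t$, the numbers $A=\mathcal A(x,y,z,t)$, $B=\mathcal B(x,y,z,t)$, $C=\mathcal C(x,y,z,t)$, $D=\mathcal D(x,y,z,t)$ satisfy $A^2+B^2+C^2=3D^2$.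
   Context: A solution $(A,B,C,D)\in\mathbb Z^4$ of $A^2+B^2+C^2=3D^2$ is called primitive if $0<A\le B\le C$ and $\gcd(A,B,C)=1$. *)

theory Defs
  imports Complex_Main
begin

definition primitive_solution :: "int \<Rightarrow> int \<Rightarrow> int \<Rightarrow> int \<Rightarrow> bool" where
  "primitive_solution A B C D \<longleftrightarrow>
     A^2 + B^2 + C^2 = 3 * D^2 \<and> 0 < A \<and> A \<le> B \<and> B \<le> C \<and> gcd A (gcd B C) = 1"

definition formA :: "int \<Rightarrow> int \<Rightarrow> int \<Rightarrow> int \<Rightarrow> int" where
  "formA x y z t = x^2 + y^2 - z^2 - t^2 + 2 * (y*z + y*t + x*z - x*t)"

definition formB :: "int \<Rightarrow> int \<Rightarrow> int \<Rightarrow> int \<Rightarrow> int" where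
  "formB x y z t = x^2 - y^2 + z^2 - t^2 + 2 * (y*z + z*t + x*t - x*y)"

definition formC :: "int \<Rightarrow> int \<Rightarrow> int \<Rightarrow> int \<Rightarrow> int" where
  "formC x y z t = x^2 - y^2 - z^2 + t^2 + 2 * (y*t + z*t + x*y - x*z)"

definition formD :: "int \<Rightarrow> int \<Rightarrow> int \<Rightarrow> int \<Rightarrow> int" where
  "formD x y z t = x^2 + y^2 + z^2 + t^2"

end

theory Submission
  imports Defs
begin

text \<open>
  Identify \<open>(x, y, z, t)\<close> with the integer quaternion \<open>q = x + y i + z j + t k\<close>, let
  \<open>s = i + j + k\<close> and \<open>v = A i + B j + C k\<close>.  The forms \<open>\<A>, \<B>, \<C>\<close> are the coordinates of
  \<open>q s q\<^sup>*\<close>, and \<open>\<D>\<close> is the norm \<open>q q\<^sup>*\<close>.  Since \<open>s\<close> has norm \<open>3\<close>, the second claim is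
  multiplicativity of the norm.

  For the first claim, with \<open>D > 0\<close>, the equation says that \<open>v / D\<close> and \<open>s\<close> are pure quaternions
  of equal norm, hence conjugate; indeed \<open>q = v + D s\<close> satisfies \<open>q s q\<^sup>* = m v\<close> and
  \<open>q q\<^sup>* = m D\<close> for a positive integer \<open>m\<close> (\<open>sandwich_start\<close>).  The task is to bring \<open>m\<close> down.
  Since \<open>a s + b\<close> commutes with \<open>s\<close> and has norm \<open>3 a\<^sup>2 + b\<^sup>2\<close>, replacing \<open>q\<close> by
  \<open>q (a s + b) / m\<close>, when this is integral, replaces \<open>m\<close> by \<open>(3 a\<^sup>2 + b\<^sup>2) / m\<close>
  (\<open>sandwich_rescale\<close>).  For every \<open>r\<close>, the quaternion \<open>v r + D r s\<close> is integral and equals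
  \<open>(2 / m) q (\<alpha> s - \<beta>)\<close>, where \<open>\<alpha>\<close> and \<open>\<beta>\<close> are the scalar products of \<open>r\<close> with
  \<open>q\<close> and with \<open>q s\<close>.  If the coordinates of \<open>q\<close> are coprime, some \<open>r\<close> has \<open>\<alpha> = 1\<close>; reducing
  \<open>2 \<beta>\<close> modulo \<open>m\<close> gives a multiplier \<open>2 s - b\<close> with \<open>\<bar>b\<bar> \<le> m / 2\<close>, and
  \<open>12 + m\<^sup>2 / 4 < m\<^sup>2\<close> as soon as \<open>m > 4\<close>.  The values \<open>m = 3, 4\<close> are reduced to \<open>1\<close> by hand, so
  the descent (\<open>sandwich_descent\<close>) ends with \<open>m = 1\<close> or \<open>m = 2\<close>.

  If \<open>m = 1\<close>, then \<open>q\<close> is the required quadruple.  If \<open>m = 2\<close>, then \<open>q\<close> has even norm and can be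
  divided on the right by \<open>1 + e\<close> for some \<open>e \<in> {i, j, k}\<close>.  The quarter turn produced by \<open>1 + e\<close>
  takes \<open>s\<close> to a vector that differs from it in one sign, and this sign can be moved to \<open>v\<close>.  This
  is where the change of signs comes from (\<open>sandwich_half\<close>).
\<close>

section \<open>Quaternions carrying the diagonal to a multiple of a given vector\<close>

text \<open>
  The conditions \<open>q s q\<^sup>* = m v\<close> and \<open>q q\<^sup>* = m D\<close>: up to the factor \<open>m\<close>, the quadruple \<open>q\<close>
  parametrizes the solution.
\<close>
definition sandwich ::
  "int \<Rightarrow> int \<Rightarrow> int \<Rightarrow> int \<Rightarrow> int \<Rightarrow> int \<Rightarrow> int \<Rightarrow> int \<Rightarrow> int \<Rightarrow> bool" where
  "sandwich A B C D m x y z t \<longleftrightarrow>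
     formA x y z t = m * A \<and> formB x y z t = m * B \<and>
     formC x y z t = m * C \<and> formD x y z t = m * D"

lemmas form_defs = formA_def formB_def formC_def formD_def

lemma form_scale:
  "formA (c * x) (c * y) (c * z) (c * t) = c\<^sup>2 * formA x y z t"
  "formB (c * x) (c * y) (c * z) (c * t) = c\<^sup>2 * formB x y z t"
  "formC (c * x) (c * y) (c * z) (c * t) = c\<^sup>2 * formC x y z t"
  "formD (c * x) (c * y) (c * z) (c * t) = c\<^sup>2 * formD x y z t"
  by (simp_all add: form_defs power2_eq_square algebra_simps)

text \<open>
  The new arguments are the coordinates of \<open>q (a s + b)\<close>.  As \<open>a s + b\<close> commutes with \<open>s\<close>,
  conjugating by it only contributes its norm \<open>3 a\<^sup>2 + b\<^sup>2\<close>.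
\<close>
lemma form_mult_diagonal:
  fixes a b x y z t :: int
  defines "x' \<equiv> b * x - a * (y + z + t)" and "y' \<equiv> b * y + a * (x + z - t)"
    and "z' \<equiv> b * z + a * (x + t - y)" and "t' \<equiv> b * t + a * (x + y - z)"
  shows "formA x' y' z' t' = (3 * a\<^sup>2 + b\<^sup>2) * formA x y z t"
    and "formB x' y' z' t' = (3 * a\<^sup>2 + b\<^sup>2) * formB x y z t"
    and "formC x' y' z' t' = (3 * a\<^sup>2 + b\<^sup>2) * formC x y z t"
    and "formD x' y' z' t' = (3 * a\<^sup>2 + b\<^sup>2) * formD x y z t"
  unfolding x'_def y'_def z'_def t'_def
  by (simp_all add: form_defs power2_eq_square algebra_simps)

lemma dvd_of_dvd_mult_coprime3:
  fixes m n A B C :: int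
  assumes "gcd A (gcd B C) = 1" "m dvd n * A" "m dvd n * B" "m dvd n * C"
  shows "m dvd n"
proof -
  have "m dvd gcd (\<bar>n\<bar> * A) (gcd (\<bar>n\<bar> * B) (\<bar>n\<bar> * C))"
    using assms(2-4) by (simp add: abs_if)
  also have "\<dots> = \<bar>n\<bar> * gcd A (gcd B C)"
    using gcd_mult_distrib_int [of "\<bar>n\<bar>"] by simp
  finally show ?thesis
    using assms(1) by simp
qed

text \<open>
  Conjugation by \<open>q (a s + b) / m\<close> takes \<open>s\<close> to \<open>((3 a\<^sup>2 + b\<^sup>2) / m) v\<close>.  As this is an
  integral vector and \<open>v\<close> is primitive, the new factor \<open>m'\<close> is an integer.
\<close>
lemma sandwich_rescale:
  fixes A B C D m x y z t a b :: int
  assumes cop: "gcd A (gcd B C) = 1" and "m > 0"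
    and q: "sandwich A B C D m x y z t"
    and q': "m * x' = b * x - a * (y + z + t)" "m * y' = b * y + a * (x + z - t)"
      "m * z' = b * z + a * (x + t - y)" "m * t' = b * t + a * (x + y - z)"
  obtains m' where "m * m' = 3 * a\<^sup>2 + b\<^sup>2" "sandwich A B C D m' x' y' z' t'"
proof -
  let ?n = "3 * a\<^sup>2 + b\<^sup>2"
  have "m\<^sup>2 * formA x' y' z' t' = ?n * (m * A)" "m\<^sup>2 * formB x' y' z' t' = ?n * (m * B)"
    "m\<^sup>2 * formC x' y' z' t' = ?n * (m * C)" "m\<^sup>2 * formD x' y' z' t' = ?n * (m * D)"
    using q unfolding form_scale [symmetric] q' form_mult_diagonal sandwich_def by simp_all
  then have eqs: "m * formA x' y' z' t' = ?n * A" "m * formB x' y' z' t' = ?n * B"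
    "m * formC x' y' z' t' = ?n * C" "m * formD x' y' z' t' = ?n * D"
    using \<open>m > 0\<close> by (simp_all add: power2_eq_square)
  have "m dvd ?n"
    using dvd_of_dvd_mult_coprime3 [OF cop] eqs by (metis dvd_triv_left)
  then obtain m' where m': "?n = m * m'"
    by (elim dvdE)
  have "sandwich A B C D m' x' y' z' t'"
    using eqs \<open>m > 0\<close> unfolding m' sandwich_def by simp
  with m' show ?thesis
    by (intro that) simp_all
qed

lemma sandwich_start:
  fixes A B C D :: int
  assumes "A\<^sup>2 + B\<^sup>2 + C\<^sup>2 = 3 * D\<^sup>2"
  shows "sandwich A B C D (2 * (3 * D + A + B + C)) 0 (A + D) (B + D) (C + D)"
  using assms by (simp add: sandwich_def form_defs power2_eq_square algebra_simps)

section \<open>Descent on the factor\<close>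

text \<open>
  A common divisor \<open>g\<close> of the coordinates can be divided out, since \<open>g\<^sup>2\<close> divides \<open>m v\<close> and
  \<open>v\<close> is primitive.
\<close>
lemma sandwich_divide_common:
  fixes A B C D m x y z t g :: int
  assumes cop: "gcd A (gcd B C) = 1" and "g \<noteq> 0"
    and q: "sandwich A B C D m (g * x) (g * y) (g * z) (g * t)"
  obtains m' where "m = g\<^sup>2 * m'" "sandwich A B C D m' x y z t"
proof -
  from q have eqs: "g\<^sup>2 * formA x y z t = m * A" "g\<^sup>2 * formB x y z t = m * B"
    "g\<^sup>2 * formC x y z t = m * C" "g\<^sup>2 * formD x y z t = m * D"
    by (simp_all add: sandwich_def form_scale)
  have "g\<^sup>2 dvd m"
    using dvd_of_dvd_mult_coprime3 [OF cop] eqs by (metis dvd_triv_left)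
  then obtain m' where m': "m = g\<^sup>2 * m'"
    by (elim dvdE)
  have "sandwich A B C D m' x y z t"
    using eqs \<open>g \<noteq> 0\<close> unfolding m' sandwich_def by (simp add: mult.assoc)
  with m' show ?thesis
    by (rule that)
qed

lemma bezout4_int:
  fixes x y z t :: int
  obtains p q r s where "p * x + q * y + r * z + s * t = gcd (gcd x y) (gcd z t)"
proof -
  obtain p q where 1: "p * x + q * y = gcd x y"
    using bezout_int by blast
  obtain r s where 2: "r * z + s * t = gcd z t"
    using bezout_int by blast
  obtain u v where "u * gcd x y + v * gcd z t = gcd (gcd x y) (gcd z t)"
    using bezout_int by blast
  then have "(u * p) * x + (u * q) * y + (v * r) * z + (v * s) * t = gcd (gcd x y) (gcd z t)"
    unfolding 1 [symmetric] 2 [symmetric] by (simp add: algebra_simps)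
  then show ?thesis
    by (rule that)
qed

lemma symmetric_residue:
  fixes c m :: int
  assumes "m > 0"
  obtains b k where "c = b + k * m" "2 * \<bar>b\<bar> \<le> m"
proof (cases "2 * (c mod m) \<le> m")
  case True
  then show ?thesis
    using assms pos_mod_sign [OF assms, of c] by (intro that [of "c mod m" "c div m"]) simp_all
next
  case False
  have "c mod m < m"
    using assms by simp
  with False show ?thesis
    by (intro that [of "c mod m - m" "c div m + 1"]) (simp_all add: algebra_simps)
qed

text \<open>
  From \<open>m v = q s q\<^sup>*\<close> and \<open>m D = q q\<^sup>*\<close> one gets
  \<open>m (v r + D r s) = q (s q\<^sup>* r + q\<^sup>* r s)\<close>, and for any quaternion \<open>p\<close> the sum \<open>s p + p s\<close> lies in the
  plane spanned by \<open>1\<close> and \<open>s\<close>; for \<open>p = q\<^sup>* r\<close> it is \<open>2 (\<alpha> s - \<beta>)\<close>, with \<open>\<alpha>\<close> and \<open>\<beta>\<close> the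
  scalar products of \<open>r\<close> with \<open>q\<close> and \<open>q s\<close>.  Choosing \<open>r\<close> with \<open>\<alpha> = 1\<close>, one finds that
  \<open>2 q (s - \<beta>)\<close> is divisible by \<open>m\<close>, and so is \<open>q (2 s - b)\<close> whenever \<open>b\<close> is congruent
  to \<open>2 \<beta>\<close> modulo \<open>m\<close>.
\<close>
lemma sandwich_small_multiplier:
  fixes A B C D m x y z t :: int
  assumes "m > 0" and q: "sandwich A B C D m x y z t"
    and cop: "gcd (gcd x y) (gcd z t) = 1"
  obtains b x' y' z' t' where "2 * \<bar>b\<bar> \<le> m"
    "m * x' = - b * x - 2 * (y + z + t)" "m * y' = - b * y + 2 * (x + z - t)"
    "m * z' = - b * z + 2 * (x + t - y)" "m * t' = - b * t + 2 * (x + y - z)"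
proof -
  obtain r0 r1 r2 r3 where r: "r0 * x + r1 * y + r2 * z + r3 * t = 1"
    using bezout4_int cop by metis
  define \<beta> where
    "\<beta> = - r0 * (y + z + t) + r1 * (x + z - t) + r2 * (x + t - y) + r3 * (x + y - z)"
  have mA: "m * A = formA x y z t" and mB: "m * B = formB x y z t"
    and mC: "m * C = formC x y z t" and mD: "m * D = formD x y z t"
    using q by (simp_all add: sandwich_def)
  \<comment> \<open>the coordinates of \<open>v r + D r s\<close>\<close>
  define w0 where "w0 = - (A * r1 + B * r2 + C * r3) - D * (r1 + r2 + r3)"
  define w1 where "w1 = A * r0 + B * r3 - C * r2 + D * (r0 + r2 - r3)"
  define w2 where "w2 = B * r0 + C * r1 - A * r3 + D * (r0 + r3 - r1)"
  define w3 where "w3 = C * r0 + A * r2 - B * r1 + D * (r0 + r1 - r2)"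
  let ?\<alpha> = "r0 * x + r1 * y + r2 * z + r3 * t"
  have "m * w0 = - (m * A * r1 + m * B * r2 + m * C * r3) - m * D * (r1 + r2 + r3)"
    by (simp add: w0_def algebra_simps)
  also have "\<dots> = 2 * (- ?\<alpha> * (y + z + t) - \<beta> * x)"
    unfolding mA mB mC mD \<beta>_def form_defs by (simp add: power2_eq_square algebra_simps)
  finally have w0: "m * w0 = 2 * (- (y + z + t) - \<beta> * x)"
    unfolding r by simp
  have "m * w1 = m * A * r0 + m * B * r3 - m * C * r2 + m * D * (r0 + r2 - r3)"
    by (simp add: w1_def algebra_simps)
  also have "\<dots> = 2 * (?\<alpha> * (x + z - t) - \<beta> * y)"
    unfolding mA mB mC mD \<beta>_def form_defs by (simp add: power2_eq_square algebra_simps)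
  finally have w1: "m * w1 = 2 * ((x + z - t) - \<beta> * y)"
    unfolding r by simp
  have "m * w2 = m * B * r0 + m * C * r1 - m * A * r3 + m * D * (r0 + r3 - r1)"
    by (simp add: w2_def algebra_simps)
  also have "\<dots> = 2 * (?\<alpha> * (x + t - y) - \<beta> * z)"
    unfolding mA mB mC mD \<beta>_def form_defs by (simp add: power2_eq_square algebra_simps)
  finally have w2: "m * w2 = 2 * ((x + t - y) - \<beta> * z)"
    unfolding r by simp
  have "m * w3 = m * C * r0 + m * A * r2 - m * B * r1 + m * D * (r0 + r1 - r2)"
    by (simp add: w3_def algebra_simps)
  also have "\<dots> = 2 * (?\<alpha> * (x + y - z) - \<beta> * t)"
    unfolding mA mB mC mD \<beta>_def form_defs by (simp add: power2_eq_square algebra_simps)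
  finally have w3: "m * w3 = 2 * ((x + y - z) - \<beta> * t)"
    unfolding r by simp
  obtain b k where bk: "2 * \<beta> = b + k * m" and small: "2 * \<bar>b\<bar> \<le> m"
    using symmetric_residue [OF \<open>m > 0\<close>] by metis
  have b: "b = 2 * \<beta> - k * m"
    using bk by simp
  show ?thesis
  proof (rule that [OF small])
    show "m * (w0 + k * x) = - b * x - 2 * (y + z + t)"
      using w0 by (simp add: b algebra_simps)
    show "m * (w1 + k * y) = - b * y + 2 * (x + z - t)"
      using w1 by (simp add: b algebra_simps)
    show "m * (w2 + k * z) = - b * z + 2 * (x + t - y)"
      using w2 by (simp add: b algebra_simps)
    show "m * (w3 + k * t) = - b * t + 2 * (x + y - z)"
      using w3 by (simp add: b algebra_simps)
  qed
qed

lemma square_mod4: "(n::int)\<^sup>2 mod 4 = (if even n then 0 else 1)"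
proof (cases "even n")
  case True
  then show ?thesis by (auto elim!: evenE simp: power2_eq_square)
next
  case False
  then obtain k where "n = 2 * k + 1" by (elim oddE)
  then have "n\<^sup>2 = 4 * (k\<^sup>2 + k) + 1" by (simp add: power2_eq_square algebra_simps)
  then show ?thesis using False by presburger
qed

text \<open>
  Here \<open>q / 2\<close> is a Hurwitz quaternion with half-integral coordinates, and one of the units
  \<open>(1 \<plusminus> s) / 2\<close> takes it to a quaternion with integral coordinates.
\<close>
lemma sandwich_four:
  fixes A B C D x y z t :: int
  assumes cop: "gcd A (gcd B C) = 1" and q: "sandwich A B C D 4 x y z t"
    and prim: "gcd (gcd x y) (gcd z t) = 1"
  shows "\<exists>x y z t. sandwich A B C D 1 x y z t"
proof -
  have "x\<^sup>2 + y\<^sup>2 + z\<^sup>2 + t\<^sup>2 = 4 * D"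
    using q by (simp add: sandwich_def formD_def)
  then have "(x\<^sup>2 mod 4 + y\<^sup>2 mod 4 + z\<^sup>2 mod 4 + t\<^sup>2 mod 4) mod 4 = 0"
    by presburger
  then have "(even x \<and> even y \<and> even z \<and> even t) \<or> (odd x \<and> odd y \<and> odd z \<and> odd t)"
    unfolding square_mod4 by (auto split: if_splits)
  moreover have "\<not> (even x \<and> even y \<and> even z \<and> even t)"
  proof
    assume "even x \<and> even y \<and> even z \<and> even t"
    then have "2 dvd gcd (gcd x y) (gcd z t)" by simp
    with prim show False by simp
  qed
  ultimately have odd: "odd x" "odd y" "odd z" "odd t" by auto
  have "\<exists>a::int. a\<^sup>2 = 1 \<and> 4 dvd x - a * (y + z + t) \<and> 4 dvd y + a * (x + z - t) \<and>
      4 dvd z + a * (x + t - y) \<and> 4 dvd t + a * (x + y - z)"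
  proof (cases "4 dvd x - (y + z + t)")
    case True
    with odd show ?thesis by (intro exI [of _ 1]) (simp, presburger)
  next
    case False
    with odd show ?thesis by (intro exI [of _ "-1"]) (simp, presburger)
  qed
  then obtain a :: int where a: "a\<^sup>2 = 1" and dvd: "4 dvd x - a * (y + z + t)"
      "4 dvd y + a * (x + z - t)" "4 dvd z + a * (x + t - y)" "4 dvd t + a * (x + y - z)"
    by blast
  from dvd obtain x' y' z' t' where q': "4 * x' = 1 * x - a * (y + z + t)"
      "4 * y' = 1 * y + a * (x + z - t)" "4 * z' = 1 * z + a * (x + t - y)"
      "4 * t' = 1 * t + a * (x + y - z)"
    unfolding mult_1_left by (metis dvdE)
  obtain m' where "4 * m' = 3 * a\<^sup>2 + 1\<^sup>2" "sandwich A B C D m' x' y' z' t'"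
    using sandwich_rescale [OF cop _ q q'] by auto
  with a show ?thesis by auto
qed

text \<open>
  For \<open>m = 3\<close> the small multiplier \<open>2 s - b\<close> gives no decrease; but \<open>3\<close> divides \<open>12 + b\<^sup>2\<close>, so
  \<open>b = 0\<close> and \<open>q s\<close> itself is divisible by \<open>3\<close>.
\<close>
lemma sandwich_three:
  fixes A B C D x y z t :: int
  assumes cop: "gcd A (gcd B C) = 1" and q: "sandwich A B C D 3 x y z t"
    and prim: "gcd (gcd x y) (gcd z t) = 1"
  shows "\<exists>x y z t. sandwich A B C D 1 x y z t"
proof -
  obtain b x' y' z' t' where b: "2 * \<bar>b\<bar> \<le> 3"
    and q': "3 * x' = - b * x - 2 * (y + z + t)" "3 * y' = - b * y + 2 * (x + z - t)"
      "3 * z' = - b * z + 2 * (x + t - y)" "3 * t' = - b * t + 2 * (x + y - z)"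
    by (rule sandwich_small_multiplier [OF _ q prim]) simp_all
  obtain m' where m': "3 * m' = 3 * 2\<^sup>2 + (- b)\<^sup>2"
    using sandwich_rescale [OF cop _ q q'] by auto
  have "b = 0 \<or> b = 1 \<or> b = -1"
    using b by linarith
  moreover have "b\<^sup>2 \<noteq> 1"
    using m' by (simp, presburger)
  ultimately have b0: "b = 0"
    by auto
  \<comment> \<open>\<open>2 q s = 3 q'\<close> gives \<open>q s = 3 (q s - q')\<close>\<close>
  have q'': "3 * (- (y + z + t) - x') = 0 * x - 1 * (y + z + t)"
      "3 * ((x + z - t) - y') = 0 * y + 1 * (x + z - t)"
      "3 * ((x + t - y) - z') = 0 * z + 1 * (x + t - y)"
      "3 * ((x + y - z) - t') = 0 * t + 1 * (x + y - z)"
    using q' b0 by simp_all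
  obtain k where "3 * k = 3 * 1\<^sup>2 + (0::int)\<^sup>2"
      "sandwich A B C D k (- (y + z + t) - x') ((x + z - t) - y') ((x + t - y) - z')
        ((x + y - z) - t')"
    using sandwich_rescale [OF cop _ q q''] by auto
  then show ?thesis by auto
qed

lemma sandwich_five:
  fixes A B C D m x y z t :: int
  assumes cop: "gcd A (gcd B C) = 1" and "m \<ge> 5" and q: "sandwich A B C D m x y z t"
    and prim: "gcd (gcd x y) (gcd z t) = 1"
  shows "\<exists>m' x y z t. 0 < m' \<and> m' < m \<and> sandwich A B C D m' x y z t"
proof -
  have "m > 0" using \<open>m \<ge> 5\<close> by simp
  obtain b x' y' z' t' where b: "2 * \<bar>b\<bar> \<le> m"
    and q': "m * x' = - b * x - 2 * (y + z + t)" "m * y' = - b * y + 2 * (x + z - t)"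
      "m * z' = - b * z + 2 * (x + t - y)" "m * t' = - b * t + 2 * (x + y - z)"
    by (rule sandwich_small_multiplier [OF \<open>m > 0\<close> q prim])
  obtain m' where m': "m * m' = 3 * 2\<^sup>2 + (- b)\<^sup>2" and s: "sandwich A B C D m' x' y' z' t'"
    using sandwich_rescale [OF cop \<open>m > 0\<close> q q'] by auto
  have "m * m' > 0"
    unfolding m' by (simp add: add_pos_nonneg)
  then have "m' > 0"
    using \<open>m > 0\<close> by (simp add: zero_less_mult_iff)
  have "(2 * \<bar>b\<bar>)\<^sup>2 \<le> m\<^sup>2"
    using b by (intro power_mono) simp_all
  then have "4 * (m * m') \<le> 48 + m\<^sup>2"
    unfolding m' by simp
  moreover have "5 * 5 \<le> m * m"
    using \<open>m \<ge> 5\<close> by (intro mult_mono) simp_all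
  ultimately have "m * m' < m * m"
    by (simp add: power2_eq_square)
  then have "m' < m"
    using \<open>m > 0\<close> by simp
  with \<open>m' > 0\<close> s show ?thesis by blast
qed

lemma sandwich_reduce:
  fixes A B C D m x y z t :: int
  assumes cop: "gcd A (gcd B C) = 1" and "m \<ge> 3" and q: "sandwich A B C D m x y z t"
  shows "\<exists>m' x y z t. 0 < m' \<and> m' < m \<and> sandwich A B C D m' x y z t"
proof (cases "gcd (gcd x y) (gcd z t) = 1")
  case True
  have "m = 3 \<or> m = 4 \<or> m \<ge> 5"
    using \<open>m \<ge> 3\<close> by linarith
  then show ?thesis
  proof (elim disjE)
    assume "m = 3"
    then obtain x' y' z' t' where "sandwich A B C D 1 x' y' z' t'"
      using sandwich_three [OF cop _ True] q by blast
    then show ?thesis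
      using \<open>m = 3\<close>
      by (intro exI [of _ 1] exI [of _ x'] exI [of _ y'] exI [of _ z'] exI [of _ t']) simp
  next
    assume "m = 4"
    then obtain x' y' z' t' where "sandwich A B C D 1 x' y' z' t'"
      using sandwich_four [OF cop _ True] q by blast
    then show ?thesis
      using \<open>m = 4\<close>
      by (intro exI [of _ 1] exI [of _ x'] exI [of _ y'] exI [of _ z'] exI [of _ t']) simp
  next
    assume "m \<ge> 5"
    then show ?thesis
      using sandwich_five [OF cop _ q True] by blast
  qed
next
  case False
  define g where "g = gcd (gcd x y) (gcd z t)"
  have "g dvd x" "g dvd y" "g dvd z" "g dvd t"
    unfolding g_def by (meson dvd_trans gcd_dvd1 gcd_dvd2)+
  then obtain x' y' z' t' where g: "x = g * x'" "y = g * y'" "z = g * z'" "t = g * t'"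
    by (metis dvdE)
  \<comment> \<open>the coordinates are not all \<open>0\<close>, as the forms would vanish and \<open>(A, B, C)\<close> is nonzero\<close>
  have "g \<noteq> 0"
  proof
    assume "g = 0"
    then have "m * A = 0" "m * B = 0" "m * C = 0"
      using q g by (simp_all add: sandwich_def form_defs)
    then show False using cop \<open>m \<ge> 3\<close> by simp
  qed
  moreover have "g \<ge> 0" by (simp add: g_def)
  ultimately have "g \<ge> 2"
    using False g_def by linarith
  obtain m' where m': "m = g\<^sup>2 * m'" and s: "sandwich A B C D m' x' y' z' t'"
    using sandwich_divide_common [OF cop \<open>g \<noteq> 0\<close>] q g by metis
  have "m' > 0"
    using m' \<open>m \<ge> 3\<close> \<open>g \<noteq> 0\<close>
    by (metis zero_less_mult_pos zero_less_power2 le_less_trans less_le_trans zero_less_numeral)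
  moreover have "m' < m"
  proof -
    have "2\<^sup>2 \<le> g\<^sup>2"
      using \<open>g \<ge> 2\<close> by (intro power_mono) simp_all
    then have "4 * m' \<le> m"
      unfolding m' using \<open>m' > 0\<close> by (intro mult_right_mono) simp_all
    then show ?thesis using \<open>m' > 0\<close> by simp
  qed
  ultimately show ?thesis using s by blast
qed

lemma sandwich_descent:
  fixes A B C D m x y z t :: int
  assumes cop: "gcd A (gcd B C) = 1" and "m > 0" and "sandwich A B C D m x y z t"
  shows "\<exists>m x y z t. m \<in> {1, 2} \<and> sandwich A B C D m x y z t"
  using assms(2,3)
proof (induction "nat m" arbitrary: m x y z t rule: less_induct)
  case less
  show ?case
  proof (cases "m \<ge> 3")
    case True
    then obtain m' x' y' z' t' where "0 < m'" "m' < m" "sandwich A B C D m' x' y' z' t'"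
      using sandwich_reduce [OF cop _ less.prems(2)] by blast
    then show ?thesis
      using less.hyps [of m' x' y' z' t'] by simp
  next
    case False
    then have "m = 1 \<or> m = 2"
      using less.prems(1) by linarith
    then show ?thesis
      using less.prems(2) by blast
  qed
qed

section \<open>Factor two and the signs\<close>

text \<open>
  Pairs of coordinates of equal parity make \<open>q (1 - e) / 2\<close> integral, with \<open>e = i, j, k\<close> for the
  three pairings of the coordinates.  With \<open>e = i\<close> this quaternion sends \<open>i - j + k\<close>, a rotated
  copy of \<open>s\<close>, to \<open>v\<close>.  The map \<open>u \<mapsto> j u j\<close> flips the sign of the \<open>j\<close>-coordinate of a pure
  quaternion; applying it to both sides, \<open>j q (1 - i) j / 2\<close> sends \<open>s\<close> to \<open>v\<close> with the sign of
  \<open>B\<close> changed.  The other pairings follow by cyclic symmetry.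
\<close>
lemma sandwich_half:
  fixes A B C D x y z t :: int
  assumes q: "sandwich A B C D 2 x y z t"
  shows "\<exists>x y z t. sandwich A (- B) C D 1 x y z t \<or> sandwich A B (- C) D 1 x y z t \<or>
    sandwich (- A) B C D 1 x y z t"
proof -
  have "x\<^sup>2 + y\<^sup>2 + z\<^sup>2 + t\<^sup>2 = 2 * D"
    using q by (simp add: sandwich_def formD_def)
  then have "even (x\<^sup>2 + y\<^sup>2 + z\<^sup>2 + t\<^sup>2)"
    by simp
  then have "even (x + y + z + t)"
    by simp
  then have "(even (x + y) \<and> even (z + t)) \<or> (even (x + z) \<and> even (y + t)) \<or>
      (even (x + t) \<and> even (y + z))"
    by auto
  then show ?thesis
  proof (elim disjE)
    assume par: "even (x + y) \<and> even (z + t)"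
    define x' y' z' t' where d: "x' = - ((x + y) div 2)" "y' = (y - x) div 2"
      "z' = (t - z) div 2" "t' = (z + t) div 2"
    have c: "x = - x' - y'" "y = y' - x'" "z = t' - z'" "t = z' + t'"
      using par unfolding d by presburger+
    then have "sandwich A (- B) C D 1 x' y' z' t'"
      using q unfolding c by (simp add: sandwich_def form_defs power2_eq_square algebra_simps)
    then show ?thesis by blast
  next
    assume par: "even (x + z) \<and> even (y + t)"
    define x' z' t' y' where d: "x' = - ((x + z) div 2)" "z' = (z - x) div 2"
      "t' = (y - t) div 2" "y' = (t + y) div 2"
    have c: "x = - x' - z'" "z = z' - x'" "t = y' - t'" "y = t' + y'"
      using par unfolding d by presburger+
    then have "sandwich A B (- C) D 1 x' y' z' t'"
      using q unfolding c by (simp add: sandwich_def form_defs power2_eq_square algebra_simps)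
    then show ?thesis by blast
  next
    assume par: "even (x + t) \<and> even (y + z)"
    define x' t' y' z' where d: "x' = - ((x + t) div 2)" "t' = (t - x) div 2"
      "y' = (z - y) div 2" "z' = (y + z) div 2"
    have c: "x = - x' - t'" "t = t' - x'" "y = z' - y'" "z = y' + z'"
      using par unfolding d by presburger+
    then have "sandwich (- A) B C D 1 x' y' z' t'"
      using q unfolding c by (simp add: sandwich_def form_defs power2_eq_square algebra_simps)
    then show ?thesis by blast
  qed
qed

lemma sandwich_up_to_signs:
  fixes A B C D :: int
  assumes eq: "A\<^sup>2 + B\<^sup>2 + C\<^sup>2 = 3 * D\<^sup>2" and "0 < A" "0 < B" "0 < C" "0 \<le> D"
    and cop: "gcd A (gcd B C) = 1"
  shows "\<exists>x y z t e1 e2 e3. e1 \<in> {1, -1} \<and> e2 \<in> {1, -1} \<and> e3 \<in> {1, -1} \<and>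
    sandwich (e1 * A) (e2 * B) (e3 * C) D 1 x y z t"
proof -
  have "2 * (3 * D + A + B + C) > 0"
    using assms by simp
  from sandwich_descent [OF cop this sandwich_start [OF eq]]
  obtain m x y z t where "m = 1 \<or> m = 2" and q: "sandwich A B C D m x y z t"
    by blast
  then consider x y z t where "sandwich A B C D 1 x y z t"
    | x y z t where "sandwich A (- B) C D 1 x y z t"
    | x y z t where "sandwich A B (- C) D 1 x y z t"
    | x y z t where "sandwich (- A) B C D 1 x y z t"
    using sandwich_half by metis
  then show ?thesis
  proof cases
    case (1 x y z t)
    then have "sandwich (1 * A) (1 * B) (1 * C) D 1 x y z t" by simp
    then show ?thesis by blast
  next
    case (2 x y z t)
    then have "sandwich (1 * A) (-1 * B) (1 * C) D 1 x y z t" by simp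
    then show ?thesis by blast
  next
    case (3 x y z t)
    then have "sandwich (1 * A) (1 * B) (-1 * C) D 1 x y z t" by simp
    then show ?thesis by blast
  next
    case (4 x y z t)
    then have "sandwich (-1 * A) (1 * B) (1 * C) D 1 x y z t" by simp
    then show ?thesis by blast
  qed
qed

theorem theorem2p1:
  "(\<forall>A B C D :: int. primitive_solution A B C D \<longrightarrow>
      (\<exists>x y z t e1 e2 e3 e4 :: int.
         e1 \<in> {1, -1} \<and> e2 \<in> {1, -1} \<and> e3 \<in> {1, -1} \<and> e4 \<in> {1, -1} \<and>
         e1 * A = formA x y z t \<and> e2 * B = formB x y z t \<and>
         e3 * C = formC x y z t \<and> e4 * D = formD x y z t)) \<and>
   (\<forall>x y z t :: int.
      (formA x y z t)^2 + (formB x y z t)^2 + (formC x y z t)^2 = 3 * (formD x y z t)^2)"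
proof (intro conjI allI impI)
  fix A B C D :: int
  assume "primitive_solution A B C D"
  then have "A\<^sup>2 + B\<^sup>2 + C\<^sup>2 = 3 * \<bar>D\<bar>\<^sup>2" "0 < A" "0 < B" "0 < C" "gcd A (gcd B C) = 1"
    by (auto simp: primitive_solution_def)
  from sandwich_up_to_signs [OF this(1-4) abs_ge_zero this(5)]
  obtain x y z t e1 e2 e3 where e: "e1 \<in> {1, -1}" "e2 \<in> {1, -1}" "e3 \<in> {1, -1}"
      and q: "sandwich (e1 * A) (e2 * B) (e3 * C) \<bar>D\<bar> 1 x y z t"
    by blast
  define e4 :: int where "e4 = (if D < 0 then -1 else 1)"
  have "e4 \<in> {1, -1}" "e4 * D = \<bar>D\<bar>"
    by (simp_all add: e4_def)
  with e q show "\<exists>x y z t e1 e2 e3 e4 :: int.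
         e1 \<in> {1, -1} \<and> e2 \<in> {1, -1} \<and> e3 \<in> {1, -1} \<and> e4 \<in> {1, -1} \<and>
         e1 * A = formA x y z t \<and> e2 * B = formB x y z t \<and>
         e3 * C = formC x y z t \<and> e4 * D = formD x y z t"
    unfolding sandwich_def mult_1_left by metis
next
  fix x y z t :: int
  show "(formA x y z t)^2 + (formB x y z t)^2 + (formC x y z t)^2 = 3 * (formD x y z t)^2"
    unfolding form_defs by algebra
qed

end
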